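(* Let $\mathbf{A}=[\underline{A},\overline{A}]$ be an $n\times n$ real interval matrix that is inverse nonnegative. Then $\det(\mathbf{A})=[\min(\mathcal{D}),\max(\mathcal{D})]$, where $\mathcal{D}=\{\det(\underline{A}),\det(\overline{A})\}$.
   Context: Inequalities between matrices are entrywise. For $\underline{A}\le\overline{A}$ in $\mathbb{R}^{n\times n}$, the interval matrix is $\mathbf{A}=\{A\in\mathbb{R}^{n\times n} : \underline{A}\le A\le\overline{A}\}$. A matrix $A\in\mathbb{R}^{n\times n}$ is inverse nonnegative if it is nonsingular and $A^{-1}\ge 0$; an interval matrix $\mathbf{A}$ is inverse nonnegative if every $A\in\mathbf{A}$ is. The range of the determinant is $\det(\mathbf{A})=\{\det(A) : A\in\mathbf{A}\}$. *)

theory Defs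
  imports "HOL-Analysis.Analysis"
begin

(* The order on vectors is componentwise, so the order on real ^ 'n ^ 'n is entrywise
   and the set {L..U} is the interval matrix [L, U]. *)
abbreviation (input) interval_matrix :: "real ^ 'n ^ 'n \<Rightarrow> real ^ 'n ^ 'n \<Rightarrow> (real ^ 'n ^ 'n) set"
  where "interval_matrix L U \<equiv> {L..U}"

definition inverse_nonnegative :: "real ^ 'n ^ 'n \<Rightarrow> bool"
  where "inverse_nonnegative A \<longleftrightarrow> invertible A \<and> 0 \<le> matrix_inv A"

definition inverse_nonnegative_interval :: "(real ^ 'n ^ 'n) set \<Rightarrow> bool"
  where "inverse_nonnegative_interval \<A> \<longleftrightarrow> (\<forall>A\<in>\<A>. inverse_nonnegative A)"

definition det_range :: "(real ^ 'n ^ 'n) set \<Rightarrow> real set"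
  where "det_range \<A> = {det A |A. A \<in> \<A>}"

end

theory Submission
  imports Defs
begin

text \<open>
  By Cramer's rule, replacing column \<open>k\<close> of \<open>A\<close> by that of some \<open>B \<ge> A\<close> multiplies the determinant
  by \<open>(A\<^sup>-\<^sup>1 B)\<^sub>k\<^sub>k\<close>, which is at least \<open>(A\<^sup>-\<^sup>1 A)\<^sub>k\<^sub>k = 1\<close> when \<open>A\<^sup>-\<^sup>1\<close> is nonnegative. Moving
  through the interval matrix column by column, the determinant keeps its sign and its absolute value
  grows, so it stays between its values at the two endpoints. Every value in between is attained
  because the interval matrix is connected.
\<close>

lemma matrix_inv_cancel:
  fixes A :: "'a::semiring_1 ^ 'n ^ 'm"
  assumes "invertible A"
  shows "matrix_inv A ** A = mat 1" and "A ** matrix_inv A = mat 1"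
proof -
  have "\<exists>A'. A ** A' = mat 1 \<and> A' ** A = mat 1"
    using assms by (simp add: invertible_def)
  then have "A ** matrix_inv A = mat 1 \<and> matrix_inv A ** A = mat 1"
    unfolding matrix_inv_def by (rule someI_ex)
  then show "matrix_inv A ** A = mat 1" and "A ** matrix_inv A = mat 1"
    by auto
qed

lemma det_replace_column:
  fixes A B :: "real ^ 'n ^ 'n"
  assumes "invertible A"
  shows "det (\<chi> i j. if j = k then B $ i $ k else A $ i $ j) = (matrix_inv A ** B) $ k $ k * det A"
proof -
  \<comment> \<open>The solution of the linear system with right-hand side \<open>column k B\<close>
    is column \<open>k\<close> of \<open>matrix_inv A ** B\<close>; its \<open>k\<close>-th
    coordinate is the factor in Cramer's rule.\<close>
  define x where "x = matrix_inv A *v column k B"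
  have "A *v x = column k B"
    by (simp add: x_def matrix_vector_mul_assoc matrix_inv_cancel[OF assms])
  moreover have "x $ k = (matrix_inv A ** B) $ k $ k"
    by (simp add: x_def matrix_vector_mult_def matrix_matrix_mult_def column_def)
  ultimately show ?thesis
    using cramer_lemma[of k A x] by (simp add: column_def cong: if_cong)
qed

text \<open>The diagonal entry pairs row \<open>k\<close> of the inverse with column
  \<open>k\<close> of \<open>B\<close>, so comparing that single column suffices.\<close>

lemma inverse_nonnegative_diag_ge_1:
  fixes A B :: "real ^ 'n ^ 'n"
  assumes "inverse_nonnegative A" and "\<And>i. A $ i $ k \<le> B $ i $ k"
  shows "1 \<le> (matrix_inv A ** B) $ k $ k"
proof -
  have inv: "invertible A" and nonneg: "0 \<le> matrix_inv A $ k $ i" for i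
    using assms(1) by (auto simp: inverse_nonnegative_def less_eq_vec_def)
  have "1 = (matrix_inv A ** A) $ k $ k"
    by (simp add: matrix_inv_cancel[OF inv] mat_def)
  also have "\<dots> \<le> (matrix_inv A ** B) $ k $ k"
    unfolding matrix_matrix_mult_def by (auto intro!: sum_mono mult_left_mono nonneg assms(2))
  finally show ?thesis .
qed

text \<open>A factor \<ge> 1 records sign preservation and growth in absolute value at once,
  whatever the sign of \<open>det A\<close>.\<close>

lemma det_multiple_of_le:
  fixes A B :: "real ^ 'n ^ 'n"
  assumes "A \<le> B" and inv: "inverse_nonnegative_interval {A..B}"
  obtains c where "1 \<le> c" and "det B = c * det A"
proof -
  define M where "M S = (\<chi> i j. if j \<in> S then B $ i $ j else A $ i $ j)" for S :: "'n set"
  have le: "A $ i $ j \<le> B $ i $ j" for i j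
    using assms(1) by (simp add: less_eq_vec_def)
  have "\<exists>c\<ge>1. det (M S) = c * det A" for S
  proof (induction S rule: finite_induct[OF finite])
    case 1
    have "M {} = A"
      by (simp add: M_def vec_eq_iff)
    then show ?case
      by (intro exI[of _ 1]) simp
  next
    case (2 k S)
    then obtain c where c: "1 \<le> c" "det (M S) = c * det A"
      by blast
    have MS: "inverse_nonnegative (M S)"
      using inv le by (auto simp: inverse_nonnegative_interval_def M_def less_eq_vec_def)
    have "M (insert k S) = (\<chi> i j. if j = k then B $ i $ k else M S $ i $ j)"
      by (auto simp: M_def vec_eq_iff)
    then have "det (M (insert k S)) = (matrix_inv (M S) ** B) $ k $ k * det (M S)"
      using MS by (simp add: det_replace_column inverse_nonnegative_def)
    moreover have "1 \<le> (matrix_inv (M S) ** B) $ k $ k"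
      using MS by (rule inverse_nonnegative_diag_ge_1) (simp add: M_def le)
    then have "1 \<le> (matrix_inv (M S) ** B) $ k $ k * c"
      using c(1) mult_mono[of 1 _ 1 c] by simp
    ultimately show ?case
      using c(2) by (intro exI[of _ "(matrix_inv (M S) ** B) $ k $ k * c"]) simp
  qed
  moreover have "M UNIV = B"
    by (simp add: M_def vec_eq_iff)
  ultimately show ?thesis
    using that by metis
qed

lemma det_between_endpoints:
  fixes L U :: "real ^ 'n ^ 'n"
  assumes "inverse_nonnegative_interval {L..U}" and "A \<in> {L..U}"
  shows "min (det L) (det U) \<le> det A" and "det A \<le> max (det L) (det U)"
proof -
  have "inverse_nonnegative_interval {L..A}" "inverse_nonnegative_interval {A..U}"
    using assms by (auto simp: inverse_nonnegative_interval_def)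
  then obtain c d where c: "1 \<le> c" "det A = c * det L" and d: "1 \<le> d" "det U = d * det A"
    using assms(2) det_multiple_of_le by (metis atLeastAtMost_iff)
  \<comment> \<open>The three determinants are ordered by absolute value and share a sign: they
    increase from \<open>L\<close> to \<open>U\<close> if nonnegative and decrease if
    nonpositive.\<close>
  have "\<bar>det L\<bar> \<le> \<bar>det A\<bar>" "\<bar>det A\<bar> \<le> \<bar>det U\<bar>"
    using c d mult_right_mono[of 1 c "\<bar>det L\<bar>"] mult_right_mono[of 1 d "\<bar>det A\<bar>"]
    by (simp_all add: abs_mult)
  moreover have "0 \<le> det L \<Longrightarrow> 0 \<le> det A" "0 \<le> det A \<Longrightarrow> 0 \<le> det U"
      "det L \<le> 0 \<Longrightarrow> det A \<le> 0" "det A \<le> 0 \<Longrightarrow> det U \<le> 0"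
    using c d by (simp_all add: mult_nonneg_nonpos)
  ultimately show "min (det L) (det U) \<le> det A" and "det A \<le> max (det L) (det U)"
    by linarith+
qed

lemma continuous_on_det: "continuous_on S (det :: real ^ 'n ^ 'n \<Rightarrow> real)"
  unfolding det_def by (intro continuous_intros)

theorem theorem10:
  fixes L U :: "real ^ 'n ^ 'n"
  assumes "L \<le> U"
    and "inverse_nonnegative_interval (interval_matrix L U)"
  shows "det_range (interval_matrix L U) = {Min {det L, det U}..Max {det L, det U}}"
proof -
  \<comment> \<open>The box is convex, so its continuous image in the reals is an interval, which
    contains everything between \<open>det L\<close> and \<open>det U\<close>.\<close>
  have "connected (det ` {L..U})"
    by (intro connected_continuous_image continuous_on_det convex_connected) simp
  then have "is_interval (det ` {L..U})"
    by (simp add: is_interval_connected_1)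
  moreover have "det L \<in> det ` {L..U}" "det U \<in> det ` {L..U}"
    using assms(1) by auto
  ultimately have "{min (det L) (det U)..max (det L) (det U)} \<subseteq> det ` {L..U}"
    by (auto simp: is_interval_1 min_def max_def split: if_splits)
  moreover have "det ` {L..U} \<subseteq> {min (det L) (det U)..max (det L) (det U)}"
    using det_between_endpoints[OF assms(2)] by auto
  moreover have "det_range {L..U} = det ` {L..U}"
    by (auto simp: det_range_def)
  ultimately show ?thesis
    by simp
qed

end
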